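(* Let $(V_1,V_2)$ be a pair of commuting isometries on a Hilbert space $\mathcal H$ such that $\mathcal W_{0,1}=\ker V_2^*$ or $\mathcal W_{1,0}=\ker V_1^*$ is finite-dimensional. Then ($H(V_1,V_2)\geq 0$ or $H(V_1,V_2)\leq 0$) if and only if $H(V_1,V_2)=0$.
   Context: Hilbert spaces are complex. For a pair $(V_1,V_2)$ of commuting isometries on $\mathcal H$, $H(V_1,V_2):=V_2V_2^*-V_1V_1^*-V_2^2V_2^{*2}+V_1V_2V_1^*V_2^*$. *)

theory Defs
  imports "HOL-Analysis.Analysis"
begin

text \<open>
  The library has no complex Hilbert spaces.  The class below puts a complex scalar
  multiplication and a complex inner product (linear in the first argument) on a real Banach
  space, in such a way that the real structure is the restriction of the complex one and the
  norm, hence the topology in which the space is complete, is the one given by the inner product.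
\<close>

class complex_hilbert = banach +
  fixes scaleC :: "complex \<Rightarrow> 'a \<Rightarrow> 'a" (infixr "*\<^sub>C" 75)
    and cinner :: "'a \<Rightarrow> 'a \<Rightarrow> complex"
  assumes scaleC_add_right: "a *\<^sub>C (x + y) = a *\<^sub>C x + a *\<^sub>C y"
    and scaleC_add_left: "(a + b) *\<^sub>C x = a *\<^sub>C x + b *\<^sub>C x"
    and scaleC_scaleC: "a *\<^sub>C (b *\<^sub>C x) = (a * b) *\<^sub>C x"
    and scaleC_one: "1 *\<^sub>C x = x"
    and scaleC_of_real: "complex_of_real r *\<^sub>C x = r *\<^sub>R x"
    and cinner_add_left: "cinner (x + y) z = cinner x z + cinner y z"
    and cinner_scaleC_left: "cinner (a *\<^sub>C x) y = a * cinner x y"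
    and cinner_commute: "cinner x y = cnj (cinner y x)"
    and cinner_self: "cinner x x = complex_of_real ((norm x)\<^sup>2)"

global_interpretation complex_vector:
  vector_space "scaleC :: complex \<Rightarrow> 'a \<Rightarrow> 'a::complex_hilbert"
  by unfold_locales
    (simp_all add: scaleC_add_right scaleC_add_left scaleC_scaleC scaleC_one)

instantiation complex :: complex_hilbert
begin

definition scaleC_complex :: "complex \<Rightarrow> complex \<Rightarrow> complex" where
  "scaleC_complex a x = a * x"

definition cinner_complex :: "complex \<Rightarrow> complex \<Rightarrow> complex" where
  "cinner_complex x y = x * cnj y"

instance
  by standard
    (simp_all add: scaleC_complex_def cinner_complex_def algebra_simps scaleR_conv_of_real
      complex_norm_square [symmetric] del: of_real_power)

end

abbreviation clinear :: "('a::complex_hilbert \<Rightarrow> 'b::complex_hilbert) \<Rightarrow> bool" where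
  "clinear \<equiv> Vector_Spaces.linear scaleC scaleC"

definition linear_isometry :: "('a::complex_hilbert \<Rightarrow> 'a) \<Rightarrow> bool" where
  "linear_isometry V \<longleftrightarrow> clinear V \<and> (\<forall>x. norm (V x) = norm x)"

definition commuting_isometries ::
    "('a::complex_hilbert \<Rightarrow> 'a) \<Rightarrow> ('a \<Rightarrow> 'a) \<Rightarrow> bool" where
  "commuting_isometries V\<^sub>1 V\<^sub>2 \<longleftrightarrow>
     linear_isometry V\<^sub>1 \<and> linear_isometry V\<^sub>2 \<and> V\<^sub>1 \<circ> V\<^sub>2 = V\<^sub>2 \<circ> V\<^sub>1"

text \<open>
  For a bounded operator the described map exists, by the Riesz representation theorem, and it is
  unique.  Nothing is claimed for other maps.
\<close>

definition cadjoint :: "('a::complex_hilbert \<Rightarrow> 'a) \<Rightarrow> ('a \<Rightarrow> 'a)" where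
  "cadjoint A = (THE B. \<forall>x y. cinner (A x) y = cinner x (B y))"

definition op_kernel :: "('a::complex_hilbert \<Rightarrow> 'a) \<Rightarrow> 'a set" where
  "op_kernel A = {x. A x = 0}"

text \<open>
  This does not use the library's dimension function, which is 0 for infinite-dimensional
  spaces.  The span is the algebraic one over the complex numbers.
\<close>

definition finite_dimensional :: "'a::complex_hilbert set \<Rightarrow> bool" where
  "finite_dimensional S \<longleftrightarrow> (\<exists>B. finite B \<and> complex_vector.span B = S)"

definition positive_operator :: "('a::complex_hilbert \<Rightarrow> 'a) \<Rightarrow> bool" where
  "positive_operator A \<longleftrightarrow> (\<forall>x. cinner (A x) x \<in> \<real> \<and> 0 \<le> Re (cinner (A x) x))"

definition operator_le ::
    "('a::complex_hilbert \<Rightarrow> 'a) \<Rightarrow> ('a \<Rightarrow> 'a) \<Rightarrow> bool" where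
  "operator_le A B \<longleftrightarrow> positive_operator (\<lambda>x. B x - A x)"

definition H_op ::
    "('a::complex_hilbert \<Rightarrow> 'a) \<Rightarrow> ('a \<Rightarrow> 'a) \<Rightarrow> ('a \<Rightarrow> 'a)" where
  "H_op V\<^sub>1 V\<^sub>2 = (\<lambda>x.
     (V\<^sub>2 \<circ> cadjoint V\<^sub>2) x - (V\<^sub>1 \<circ> cadjoint V\<^sub>1) x
     - (V\<^sub>2 ^^ 2 \<circ> cadjoint V\<^sub>2 ^^ 2) x
     + (V\<^sub>1 \<circ> V\<^sub>2 \<circ> cadjoint V\<^sub>1 \<circ> cadjoint V\<^sub>2) x)"

end

theory Submission
  imports Defs
begin

text \<open>
  Write \<open>W\<^sub>i = ker V\<^sub>i\<^sup>*\<close>.  Then \<open>H(V\<^sub>1, V\<^sub>2)\<close> is the difference of the projections onto \<open>V\<^sub>2 W\<^sub>2\<close>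
  and \<open>V\<^sub>1 W\<^sub>2\<close>, so semidefiniteness means that one of these subspaces contains the other.
  If \<open>V\<^sub>1 W\<^sub>2 \<subseteq> V\<^sub>2 W\<^sub>2\<close>, then \<open>V\<^sub>2\<^sup>* V\<^sub>1\<close> is an isometry of \<open>W\<^sub>2\<close> into \<open>W\<^sub>1 \<inter> W\<^sub>2\<close>; if
  \<open>V\<^sub>2 W\<^sub>2 \<subseteq> V\<^sub>1 W\<^sub>2\<close>, then \<open>W\<^sub>2 \<subseteq> W\<^sub>1\<close> and \<open>V\<^sub>1\<^sup>* V\<^sub>2\<close> is an isometry of \<open>W\<^sub>2\<close> into itself.  Either
  way \<open>W\<^sub>2\<close> is finite-dimensional as soon as \<open>W\<^sub>1\<close> or \<open>W\<^sub>2\<close> is, so the isometry is onto \<open>W\<^sub>2\<close>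
  and the inclusion is an equality.
\<close>

section \<open>Identities for the inner product and the norm\<close>

lemma cinner_add_right: "cinner x (y + z) = cinner x y + cinner x (z::'a::complex_hilbert)"
  by (metis cinner_add_left cinner_commute complex_cnj_add)

lemma cinner_scaleC_right: "cinner x (a *\<^sub>C y) = cnj a * cinner x (y::'a::complex_hilbert)"
  by (metis cinner_scaleC_left cinner_commute complex_cnj_mult)

lemma cinner_zero_left [simp]: "cinner 0 (x::'a::complex_hilbert) = 0"
  by (metis add_cancel_left_left cinner_add_left)

lemma cinner_zero_right [simp]: "cinner (x::'a::complex_hilbert) 0 = 0"
  by (metis add_cancel_left_left cinner_add_right)

lemma cinner_diff_left: "cinner (x - y) z = cinner x z - cinner y (z::'a::complex_hilbert)"
  by (metis add_diff_cancel cinner_add_left diff_add_cancel)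

lemma cinner_diff_right: "cinner x (y - z) = cinner x y - cinner x (z::'a::complex_hilbert)"
  by (metis add_diff_cancel cinner_add_right diff_add_cancel)

lemma cinner_minus_left: "cinner (- x) y = - cinner x (y::'a::complex_hilbert)"
  by (metis cinner_diff_left cinner_zero_left diff_0)

lemma Re_cinner_self: "Re (cinner x x) = (norm (x::'a::complex_hilbert))\<^sup>2"
  by (simp add: cinner_self)

lemma cinner_self_eq_0_iff: "cinner x x = 0 \<longleftrightarrow> x = (0::'a::complex_hilbert)"
  by (simp add: cinner_self)

lemma Re_cinner_commute: "Re (cinner x y) = Re (cinner y (x::'a::complex_hilbert))"
  by (subst cinner_commute) simp

lemma cinner_right_eqI:
  fixes y z :: "'a::complex_hilbert"
  assumes "\<And>x. cinner x y = cinner x z"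
  shows "y = z"
  using assms [of "y - z"]
  by (metis cinner_diff_right cinner_self_eq_0_iff eq_iff_diff_eq_0)

lemma norm_add_square:
  "(norm (x + y))\<^sup>2 = (norm x)\<^sup>2 + (norm y)\<^sup>2 + 2 * Re (cinner x (y::'a::complex_hilbert))"
  using Re_cinner_commute [of x y]
  by (simp add: Re_cinner_self [symmetric] cinner_add_left cinner_add_right)

lemma norm_diff_square:
  "(norm (x - y))\<^sup>2 = (norm x)\<^sup>2 + (norm y)\<^sup>2 - 2 * Re (cinner x (y::'a::complex_hilbert))"
  using Re_cinner_commute [of x y]
  by (simp add: Re_cinner_self [symmetric] cinner_diff_left cinner_diff_right)

lemma norm_scaleC: "norm (a *\<^sub>C x) = cmod a * norm (x::'a::complex_hilbert)"
proof -
  have "cinner (a *\<^sub>C x) (a *\<^sub>C x) = (a * cnj a) * cinner x x"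
    by (simp add: cinner_scaleC_left cinner_scaleC_right mult.assoc)
  then have "(norm (a *\<^sub>C x))\<^sup>2 = (cmod a * norm x)\<^sup>2"
    by (metis Re_cinner_self Re_complex_of_real cinner_self complex_norm_square of_real_mult
        power_mult_distrib)
  then show ?thesis
    by simp
qed

section \<open>Complex-linear maps and isometries\<close>

lemma clinear_add: "clinear f \<Longrightarrow> f (x + y) = f x + f y"
  by (simp add: Vector_Spaces.linear_iff)

lemma clinear_scaleC: "clinear f \<Longrightarrow> f (a *\<^sub>C x) = a *\<^sub>C f x"
  by (simp add: Vector_Spaces.linear_iff)

lemma clinear_diff: "clinear f \<Longrightarrow> f (x - y) = f x - f y"
  by (metis add_diff_cancel clinear_add diff_add_cancel)

lemma clinear_0: "clinear f \<Longrightarrow> f 0 = 0"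
  by (metis clinear_diff diff_self)

lemma clinearI:
  assumes "\<And>x y. f (x + y) = f x + f y" and "\<And>a x. f (a *\<^sub>C x) = a *\<^sub>C f x"
  shows "clinear f"
  using assms by (simp add: Vector_Spaces.linear_iff complex_vector.vector_space_axioms)

lemma linear_isometry_clinear: "linear_isometry V \<Longrightarrow> clinear V"
  and linear_isometry_norm: "linear_isometry V \<Longrightarrow> norm (V x) = norm x"
  by (auto simp: linear_isometry_def)

text \<open>Polarization: preserved norms of sums give preserved real parts, and multiplying
  \<open>x\<close> by the imaginary unit turns imaginary parts into real ones.\<close>

lemma linear_isometry_cinner:
  assumes "linear_isometry V"
  shows "cinner (V x) (V y) = cinner x y"
proof -
  note lin = linear_isometry_clinear [OF assms]
  have re: "Re (cinner (V x) (V y)) = Re (cinner x y)" for x y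
    using norm_add_square [of "V x" "V y"] norm_add_square [of x y]
    by (simp add: clinear_add [OF lin, symmetric] linear_isometry_norm [OF assms])
  show ?thesis
    using re [of x y] re [of "\<i> *\<^sub>C x" y]
    by (simp add: complex_eq_iff clinear_scaleC [OF lin] cinner_scaleC_left)
qed

lemma linear_isometry_inj: "linear_isometry V \<Longrightarrow> inj V"
proof (rule injI)
  fix x y assume V: "linear_isometry V" and "V x = V y"
  then have "norm (x - y) = 0"
    using linear_isometry_norm [OF V, of "x - y"]
    by (simp add: clinear_diff [OF linear_isometry_clinear [OF V]])
  then show "x = y"
    by simp
qed

section \<open>Existence of the adjoint of an isometry\<close>

text \<open>A minimizing sequence is Cauchy by the parallelogram law. Since \<open>V\<close>
  preserves norms, the estimate can be made on the arguments, so completeness of the space gives the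
  minimizer without a separate proof that the range of \<open>V\<close> is closed.\<close>

lemma linear_isometry_closest_point:
  fixes V :: "'a::complex_hilbert \<Rightarrow> 'a"
  assumes V: "linear_isometry V"
  obtains x where "\<And>z. norm (V x - y) \<le> norm (V z - y)"
proof -
  note lin = linear_isometry_clinear [OF V]
  define g where "g z = (norm (V z - y))\<^sup>2" for z
  define D where "D = (INF z. g z)"
  have bdd: "bdd_below (range g)"
    by (rule bdd_belowI [of _ 0]) (auto simp: g_def)
  have D_le: "D \<le> g z" for z
    unfolding D_def by (rule cINF_lower [OF bdd]) simp
  have "\<exists>z. g z < D + 1 / real (Suc n)" for n
    using cINF_less_iff [of UNIV g "D + 1 / real (Suc n)"] bdd by (simp add: D_def)
  then obtain X where X: "\<And>n. g (X n) < D + 1 / real (Suc n)"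
    by metis
  \<comment> \<open>Parallelogram law for the residuals \<open>p\<close> and \<open>q\<close>: half
    of \<open>p + q\<close> is the residual at the midpoint of \<open>X m\<close> and
    \<open>X n\<close>, so its squared norm is at least \<open>D\<close>.\<close>
  have step: "(norm (X m - X n))\<^sup>2 \<le> 2 / real (Suc m) + 2 / real (Suc n)" for m n
  proof -
    define p q where "p = V (X m) - y" and "q = V (X n) - y"
    define c :: complex where "c = of_real (1/2)"
    have half: "c *\<^sub>C u = (1/2) *\<^sub>R u" for u :: 'a
      unfolding c_def by (rule scaleC_of_real)
    have "V (c *\<^sub>C (X m + X n)) = (1/2) *\<^sub>R (V (X m) + V (X n))"
      by (metis clinear_scaleC [OF lin] clinear_add [OF lin] half)
    also have "\<dots> - y = (1/2) *\<^sub>R (p + q)"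
      by (simp add: p_def q_def algebra_simps flip: scaleR_add_left)
    finally have "V (c *\<^sub>C (X m + X n)) - y = (1/2) *\<^sub>R (p + q)" .
    then have "g (c *\<^sub>C (X m + X n)) = (norm (p + q))\<^sup>2 / 4"
      by (simp add: g_def power_divide)
    then have "4 * D \<le> (norm (p + q))\<^sup>2"
      using D_le [of "c *\<^sub>C (X m + X n)"] by simp
    moreover have "V (X m - X n) = p - q"
      by (simp add: clinear_diff [OF lin] p_def q_def)
    then have "norm (X m - X n) = norm (p - q)"
      by (metis linear_isometry_norm [OF V])
    moreover have "(norm (p + q))\<^sup>2 + (norm (p - q))\<^sup>2 = 2 * (norm p)\<^sup>2 + 2 * (norm q)\<^sup>2"
      by (simp add: norm_add_square norm_diff_square)
    moreover have "(norm p)\<^sup>2 < D + 1 / real (Suc m)" "(norm q)\<^sup>2 < D + 1 / real (Suc n)"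
      using X [of m] X [of n] by (simp_all add: g_def p_def q_def)
    ultimately show ?thesis
      by simp
  qed
  have "Cauchy X"
  proof (rule CauchyI)
    fix e :: real assume "0 < e"
    \<comment> \<open>From index \<open>N\<close> on, each of the two terms in \<open>step\<close>
      is at most \<open>2 / real (Suc N)\<close>, so their sum stays below the square of
      \<open>e\<close>.\<close>
    then obtain N where N: "inverse (real (Suc N)) < e\<^sup>2 / 4"
      using reals_Archimedean [of "e\<^sup>2 / 4"] by auto
    show "\<exists>M. \<forall>m\<ge>M. \<forall>n\<ge>M. norm (X m - X n) < e"
    proof (intro exI allI impI)
      fix m n assume "N \<le> m" "N \<le> n"
      then have "1 / real (Suc m) \<le> 1 / real (Suc N)" "1 / real (Suc n) \<le> 1 / real (Suc N)"
        by (simp_all add: frac_le)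
      with step [of m n] N have "(norm (X m - X n))\<^sup>2 < e\<^sup>2"
        by (simp add: inverse_eq_divide)
      with \<open>0 < e\<close> show "norm (X m - X n) < e"
        by (simp add: power_less_imp_less_base)
    qed
  qed
  then obtain x where x: "X \<longlonglongrightarrow> x"
    using Cauchy_convergent_iff convergent_def by blast
  have "(\<lambda>n. V (X n)) \<longlonglongrightarrow> V x"
    using x unfolding LIMSEQ_iff
    by (simp add: clinear_diff [OF lin, symmetric] linear_isometry_norm [OF V])
  then have "(\<lambda>n. g (X n)) \<longlonglongrightarrow> g x"
    unfolding g_def by (intro tendsto_intros)
  moreover have "(\<lambda>n. D + 1 / real (Suc n)) \<longlonglongrightarrow> D + 0"
    by (intro tendsto_add tendsto_const LIMSEQ_Suc [OF lim_1_over_n])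
  ultimately have "g x \<le> D"
    using X by (intro LIMSEQ_le [of "\<lambda>n. g (X n)" _ "\<lambda>n. D + 1 / real (Suc n)"])
      (auto intro: less_imp_le)
  with D_le have "g x \<le> g z" for z
    by (meson order_trans)
  then have "norm (V x - y) \<le> norm (V z - y)" for z
    unfolding g_def by (meson norm_ge_zero power2_le_imp_le)
  then show ?thesis ..
qed

text \<open>The residual at the point \<open>V x\<close> closest to \<open>y\<close> is orthogonal
  to the range of \<open>V\<close>, so \<open>V z\<close> has the same inner product with
  \<open>y\<close> as with \<open>V x\<close>. This takes the place of the Riesz representation
  theorem.\<close>

lemma linear_isometry_adjoint_exists:
  fixes V :: "'a::complex_hilbert \<Rightarrow> 'a"
  assumes V: "linear_isometry V"
  shows "\<exists>x. \<forall>z. cinner (V z) y = cinner z x"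
proof -
  note lin = linear_isometry_clinear [OF V]
  obtain x where x: "\<And>z. norm (V x - y) \<le> norm (V z - y)"
    using linear_isometry_closest_point [OF V] by metis
  define r where "r = V x - y"
  have "cinner r (V z) = 0" for z
  proof (rule ccontr)
    define c where "c = cinner r (V z)"
    \<comment> \<open>Moving \<open>x\<close> by \<open>a *\<^sub>C z\<close> changes the squared
      distance by \<open>s * |c|^2 * (s * |z|^2 - 2)\<close>, which is negative. The summand 1 in
      the denominator avoids a case distinction on \<open>z = 0\<close>.\<close>
    define s where "s = 1 / (1 + (norm z)\<^sup>2)"
    define a where "a = - (of_real s * c)"
    assume "cinner r (V z) \<noteq> 0"
    then have c: "0 < (cmod c)\<^sup>2"
      by (simp add: c_def)
    have "V (x + a *\<^sub>C z) - y = r + a *\<^sub>C V z"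
      by (simp add: r_def clinear_add [OF lin] clinear_scaleC [OF lin])
    with x [of "x + a *\<^sub>C z"] have "(norm r)\<^sup>2 \<le> (norm (r + a *\<^sub>C V z))\<^sup>2"
      by (simp add: r_def)
    moreover have "(norm (a *\<^sub>C V z))\<^sup>2 = s\<^sup>2 * (cmod c)\<^sup>2 * (norm z)\<^sup>2"
      by (simp add: norm_scaleC linear_isometry_norm [OF V] a_def norm_mult power_mult_distrib)
    moreover have "cinner r (a *\<^sub>C V z) = - of_real s * (c * cnj c)"
      unfolding cinner_scaleC_right by (simp add: a_def c_def mult_ac)
    then have "Re (cinner r (a *\<^sub>C V z)) = - (s * (cmod c)\<^sup>2)"
      by (simp add: complex_norm_square [symmetric] del: of_real_power)
    ultimately have "0 \<le> s * (cmod c)\<^sup>2 * (s * (norm z)\<^sup>2 - 2)"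
      unfolding norm_add_square by (simp add: power2_eq_square algebra_simps)
    moreover have "0 < s"
      by (simp add: s_def add_pos_nonneg)
    moreover have "s * (norm z)\<^sup>2 \<le> 1"
      by (simp add: s_def divide_simps add_pos_nonneg)
    moreover from \<open>0 < s\<close> c have "0 < s * (cmod c)\<^sup>2"
      by (rule mult_pos_pos)
    ultimately show False
      by (simp add: zero_le_mult_iff)
  qed
  then have "cinner (V z) r = 0" for z
    by (metis cinner_commute complex_cnj_zero)
  then have "cinner (V z) y = cinner (V z) (V x)" for z
    unfolding r_def by (metis cinner_diff_right eq_iff_diff_eq_0)
  then show ?thesis
    using linear_isometry_cinner [OF V] by metis
qed

section \<open>Properties of the adjoint\<close>

text \<open>Evaluates the definite description: existence was shown above, and a vector is
  determined by its inner products with all vectors.\<close>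

lemma cinner_cadjoint_right:
  assumes "linear_isometry V"
  shows "cinner x (cadjoint V y) = cinner (V x) y"
proof -
  obtain B where B: "\<forall>x y. cinner (V x) y = cinner x (B y)"
    using linear_isometry_adjoint_exists [OF assms] by metis
  have "cadjoint V = B"
    unfolding cadjoint_def
  proof (rule the_equality)
    show "\<forall>x y. cinner (V x) y = cinner x (B y)"
      by (fact B)
    fix B' assume "\<forall>x y. cinner (V x) y = cinner x (B' y)"
    with B show "B' = B"
      by (metis cinner_right_eqI ext)
  qed
  with B show ?thesis
    by simp
qed

lemma cinner_cadjoint_left:
  "linear_isometry V \<Longrightarrow> cinner (cadjoint V x) y = cinner x (V y)"
  by (metis cinner_cadjoint_right cinner_commute)

lemma cadjoint_clinear:
  assumes "linear_isometry V"
  shows "clinear (cadjoint V)"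
  by (rule clinearI; rule cinner_right_eqI)
    (simp_all add: cinner_cadjoint_right [OF assms] cinner_add_right cinner_scaleC_right)

lemma cadjoint_isometry [simp]: "linear_isometry V \<Longrightarrow> cadjoint V (V x) = x"
  by (rule cinner_right_eqI) (simp add: cinner_cadjoint_right linear_isometry_cinner)

text \<open>\<open>V\<close> after its adjoint is the orthogonal projection onto the range of
  \<open>V\<close>; a vector no longer than its projection lies in the range.\<close>

lemma isometry_cadjoint_eqI:
  assumes V: "linear_isometry V" and "norm x \<le> norm (cadjoint V x)"
  shows "V (cadjoint V x) = x"
proof -
  have "cinner x (V (cadjoint V x)) = cinner (cadjoint V x) (cadjoint V x)"
    by (simp add: cinner_cadjoint_left [OF V])
  then have "(norm (x - V (cadjoint V x)))\<^sup>2 = (norm x)\<^sup>2 - (norm (cadjoint V x))\<^sup>2"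
    by (simp add: norm_diff_square linear_isometry_norm [OF V] Re_cinner_self)
  also have "\<dots> \<le> 0"
    using assms(2) by (simp add: power_mono)
  finally show ?thesis
    by simp
qed

lemma cadjoint_commute:
  assumes "linear_isometry A" "linear_isometry B" "A \<circ> B = B \<circ> A"
  shows "cadjoint A (cadjoint B x) = cadjoint B (cadjoint A x)"
  by (rule cinner_right_eqI)
    (use assms(3) in \<open>simp add: cinner_cadjoint_right assms(1,2) fun_eq_iff\<close>)

lemma subspace_op_kernel:
  "clinear A \<Longrightarrow> complex_vector.subspace (op_kernel A)"
  by (simp add: complex_vector.subspace_def op_kernel_def clinear_0 clinear_add clinear_scaleC)

section \<open>Injective endomorphisms and equality of images\<close>

text \<open>Finiteness is assumed of the image only: a basis of \<open>S\<close> is carried to an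
  independent set in \<open>span F\<close>, which makes the basis finite. A dimension count then
  applies.\<close>

lemma (in vector_space) injective_endomorphism_surj:
  assumes S: "subspace S" and f: "Vector_Spaces.linear scale scale f" and inj: "inj_on f S"
    and sub: "f ` S \<subseteq> S" and fin: "finite F" "f ` S \<subseteq> span F"
  shows "f ` S = S"
proof -
  interpret vector_space_pair scale scale ..
  obtain C where C: "C \<subseteq> S" "independent C" "S \<subseteq> span C"
    using maximal_independent_subset by blast
  have span_C: "span C = S"
    using C S span_minimal by blast
  have indep: "independent (f ` C)"
    using linear_independent_injective_image [OF f C(2)] inj span_C by simp
  have "finite (f ` C)"
    using independent_span_bound [OF fin(1) indep] C(1) fin(2) by blast
  moreover have inj_C: "inj_on f C"
    using inj C(1) inj_on_subset by blast
  ultimately have "finite C"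
    using finite_imageD by blast
  have span_image: "span (f ` C) = f ` S"
    using linear_span_image [OF f] span_C by simp
  have "y \<in> f ` S" if "y \<in> S" for y
  proof (rule ccontr)
    assume "y \<notin> f ` S"
    then have y: "y \<notin> span (f ` C)"
      by (simp add: span_image)
    \<comment> \<open>Adjoining \<open>y\<close> would give more independent vectors in
      \<open>span C\<close> than \<open>C\<close> has elements.\<close>
    then have "independent (insert y (f ` C))"
      using indep by (simp add: independent_insertI)
    moreover have "insert y (f ` C) \<subseteq> span C"
      using that C(1) sub span_C by blast
    ultimately have "card (insert y (f ` C)) \<le> card C"
      using independent_span_bound [OF \<open>finite C\<close>] by blast
    moreover have "y \<notin> f ` C"
      using y span_base by blast
    ultimately show False
      using \<open>finite C\<close> card_image [OF inj_C] by simp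
  qed
  with sub show ?thesis
    by blast
qed

text \<open>The adjoint of \<open>B\<close> after \<open>A\<close> sends \<open>w\<close> to
  \<open>u\<close>, hence is an injective endomorphism of \<open>W\<close> with image in
  \<open>U\<close>, and so is onto \<open>W\<close>; applying \<open>B\<close> to it gives back
  \<open>A\<close>. Keeping \<open>U\<close> apart from \<open>W\<close> allows either kernel to be
  the finite-dimensional one.\<close>

lemma isometry_images_eqI:
  fixes A B :: "'a::complex_hilbert \<Rightarrow> 'a"
  assumes A: "linear_isometry A" and B: "linear_isometry B"
    and W: "complex_vector.subspace W"
    and fin: "finite_dimensional U"
    and ex: "\<And>w. w \<in> W \<Longrightarrow> \<exists>u \<in> W \<inter> U. A w = B u"
  shows "A ` W = B ` W"
proof -
  let ?T = "\<lambda>w. cadjoint B (A w)"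
  obtain F where F: "finite F" "complex_vector.span F = U"
    using fin by (auto simp: finite_dimensional_def)
  have T: "?T w \<in> W" "?T w \<in> U" "B (?T w) = A w" if "w \<in> W" for w
    using ex [OF that] B by auto
  have "clinear ?T"
    using linear_isometry_clinear [OF A] cadjoint_clinear [OF B]
    by (intro clinearI) (simp_all add: clinear_add clinear_scaleC)
  moreover have "inj_on ?T W"
  proof (rule inj_onI)
    fix v w assume vw: "v \<in> W" "w \<in> W" and "?T v = ?T w"
    then have "A v = A w"
      using T(3) [OF vw(1)] T(3) [OF vw(2)] by metis
    then show "v = w"
      by (rule injD [OF linear_isometry_inj [OF A]])
  qed
  moreover have "?T ` W \<subseteq> W" "?T ` W \<subseteq> complex_vector.span F"
    using T(1,2) F(2) by blast+
  ultimately have "?T ` W = W"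
    by (intro complex_vector.injective_endomorphism_surj [OF W _ _ _ F(1)])
  then have "B ` W = B ` ?T ` W"
    by (simp only:)
  also have "\<dots> = (\<lambda>w. B (?T w)) ` W"
    by (rule image_image)
  also have "\<dots> = A ` W"
    using T(3) by (rule image_cong [OF refl])
  finally show ?thesis ..
qed

section \<open>The operator \<open>H_op\<close> as a difference of projections\<close>

text \<open>Up to sign, each term of \<open>H_op\<close> is an operator times its own adjoint, the
  last one because \<open>V\<^sub>1\<close> and \<open>V\<^sub>2\<close> commute.\<close>

lemma cinner_H_op_left:
  assumes "linear_isometry V\<^sub>1" "linear_isometry V\<^sub>2" "V\<^sub>1 \<circ> V\<^sub>2 = V\<^sub>2 \<circ> V\<^sub>1"
  shows "cinner (H_op V\<^sub>1 V\<^sub>2 x) y =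
    cinner (cadjoint V\<^sub>2 x) (cadjoint V\<^sub>2 y) - cinner (cadjoint V\<^sub>1 x) (cadjoint V\<^sub>1 y)
    - cinner (cadjoint V\<^sub>2 (cadjoint V\<^sub>2 x)) (cadjoint V\<^sub>2 (cadjoint V\<^sub>2 y))
    + cinner (cadjoint V\<^sub>2 (cadjoint V\<^sub>1 x)) (cadjoint V\<^sub>2 (cadjoint V\<^sub>1 y))"
  using assms cadjoint_commute [OF assms]
  by (simp add: H_op_def cinner_add_left cinner_diff_left cinner_cadjoint_right numeral_2_eq_2
      fun_eq_iff)

text \<open>Each value of \<open>H_op\<close> lies in the common image of the kernel. On that image
  the contributions of the two isometries cancel, so the value is orthogonal to itself.\<close>

lemma H_op_eq_0I:
  assumes V: "linear_isometry V\<^sub>1" "linear_isometry V\<^sub>2" "V\<^sub>1 \<circ> V\<^sub>2 = V\<^sub>2 \<circ> V\<^sub>1"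
    and eq: "V\<^sub>1 ` op_kernel (cadjoint V\<^sub>2) = V\<^sub>2 ` op_kernel (cadjoint V\<^sub>2)"
  shows "H_op V\<^sub>1 V\<^sub>2 = (\<lambda>_. 0)"
proof
  fix x
  let ?W = "op_kernel (cadjoint V\<^sub>2)"
  note lin = linear_isometry_clinear [OF V(1)] linear_isometry_clinear [OF V(2)]
    cadjoint_clinear [OF V(2)]
  \<comment> \<open>\<open>p\<close> is the orthogonal projection onto \<open>?W\<close>.\<close>
  define p where "p y = y - V\<^sub>2 (cadjoint V\<^sub>2 y)" for y
  have p: "p y \<in> ?W" for y
    by (simp add: p_def op_kernel_def clinear_diff [OF lin(3)] V)
  have H: "H_op V\<^sub>1 V\<^sub>2 x = V\<^sub>2 (p (cadjoint V\<^sub>2 x)) - V\<^sub>1 (p (cadjoint V\<^sub>1 x))"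
    by (simp add: H_op_def p_def clinear_diff [OF lin(1)] clinear_diff [OF lin(2)]
        numeral_2_eq_2 cadjoint_commute [OF V])
  obtain w where w: "w \<in> ?W" "V\<^sub>1 (p (cadjoint V\<^sub>1 x)) = V\<^sub>2 w"
    using p eq by (metis (no_types, lifting) image_iff)
  define v where "v = p (cadjoint V\<^sub>2 x) - w"
  have v: "v \<in> ?W"
    using complex_vector.subspace_diff [OF subspace_op_kernel [OF lin(3)] p w(1)]
    by (simp add: v_def)
  then obtain u where u: "u \<in> ?W" "V\<^sub>2 v = V\<^sub>1 u"
    using eq by (metis (no_types, lifting) image_iff)
  have Hv: "H_op V\<^sub>1 V\<^sub>2 x = V\<^sub>2 v"
    by (simp add: H w(2) v_def clinear_diff [OF lin(2)])
  \<comment> \<open>Both sides are the inner product of \<open>x\<close> with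
    \<open>V\<^sub>2 v\<close>. The other two terms of the form vanish because \<open>u\<close> and
    \<open>v\<close> lie in \<open>?W\<close>.\<close>
  have "cinner (cadjoint V\<^sub>2 x) v = cinner (cadjoint V\<^sub>1 x) u"
    using u(2) by (simp add: cinner_cadjoint_left V)
  moreover have "cadjoint V\<^sub>1 (V\<^sub>2 v) = u"
    using u(2) V by simp
  ultimately have "cinner (H_op V\<^sub>1 V\<^sub>2 x) (V\<^sub>2 v) = 0"
    using u(1) v V by (simp add: cinner_H_op_left [OF V] op_kernel_def)
  then show "H_op V\<^sub>1 V\<^sub>2 x = 0"
    by (simp add: Hv cinner_self_eq_0_iff)
qed

section \<open>Factorizations forced by semidefiniteness\<close>

lemma Re_cinner_H_op:
  assumes "linear_isometry V\<^sub>1" "linear_isometry V\<^sub>2" "V\<^sub>1 \<circ> V\<^sub>2 = V\<^sub>2 \<circ> V\<^sub>1"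
  shows "Re (cinner (H_op V\<^sub>1 V\<^sub>2 x) x) =
    (norm (cadjoint V\<^sub>2 x))\<^sup>2 - (norm (cadjoint V\<^sub>1 x))\<^sup>2
    - (norm (cadjoint V\<^sub>2 (cadjoint V\<^sub>2 x)))\<^sup>2 + (norm (cadjoint V\<^sub>2 (cadjoint V\<^sub>1 x)))\<^sup>2"
  by (simp add: cinner_H_op_left [OF assms] Re_cinner_self)

text \<open>At \<open>V\<^sub>1 w\<close> the quadratic form is
  \<open>|u|^2 - |w|^2 - |cadjoint V\<^sub>2 u|^2\<close>, where \<open>u\<close> is the adjoint of
  \<open>V\<^sub>2\<close> applied to \<open>V\<^sub>1 w\<close>. As \<open>|u|\<close> is at most
  \<open>|w|\<close>, nonnegativity forces equality and the last term to vanish.\<close>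

lemma H_op_nonneg_imp_factor:
  assumes V: "linear_isometry V\<^sub>1" "linear_isometry V\<^sub>2" "V\<^sub>1 \<circ> V\<^sub>2 = V\<^sub>2 \<circ> V\<^sub>1"
    and pos: "operator_le (\<lambda>_. 0) (H_op V\<^sub>1 V\<^sub>2)"
    and w: "w \<in> op_kernel (cadjoint V\<^sub>2)"
  shows "\<exists>u \<in> op_kernel (cadjoint V\<^sub>1) \<inter> op_kernel (cadjoint V\<^sub>2). V\<^sub>1 w = V\<^sub>2 u"
proof
  let ?u = "cadjoint V\<^sub>2 (V\<^sub>1 w)"
  have w0: "cadjoint V\<^sub>2 w = 0"
    using w by (simp add: op_kernel_def)
  have "0 \<le> Re (cinner (H_op V\<^sub>1 V\<^sub>2 (V\<^sub>1 w)) (V\<^sub>1 w))"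
    using pos by (simp add: operator_le_def positive_operator_def)
  then have ineq: "(norm (V\<^sub>1 w))\<^sup>2 + (norm (cadjoint V\<^sub>2 ?u))\<^sup>2 \<le> (norm ?u)\<^sup>2"
    by (simp add: Re_cinner_H_op [OF V] V w0 linear_isometry_norm [OF V(1)])
  then have "(norm (V\<^sub>1 w))\<^sup>2 \<le> (norm ?u)\<^sup>2"
    by (smt (verit) zero_le_power2)
  then have "norm (V\<^sub>1 w) \<le> norm ?u"
    by (rule power2_le_imp_le) simp
  then have u: "V\<^sub>2 ?u = V\<^sub>1 w"
    by (rule isometry_cadjoint_eqI [OF V(2)])
  then show "V\<^sub>1 w = V\<^sub>2 ?u"
    by simp
  have "norm ?u = norm (V\<^sub>1 w)"
    by (metis u linear_isometry_norm [OF V(2)])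
  with ineq have "cadjoint V\<^sub>2 ?u = 0"
    by simp
  moreover have "cadjoint V\<^sub>1 ?u = 0"
    by (simp add: cadjoint_commute [OF V] V w0)
  ultimately show "?u \<in> op_kernel (cadjoint V\<^sub>1) \<inter> op_kernel (cadjoint V\<^sub>2)"
    by (simp add: op_kernel_def)
qed

text \<open>The same test at \<open>V\<^sub>2 w\<close>, with the adjoint of
  \<open>V\<^sub>1\<close>. Interchanging the adjoints makes the form
  \<open>|w|^2 + |cadjoint V\<^sub>1 w|^2 - |u|^2\<close>, so nonpositivity forces
  \<open>|u| = |w|\<close> and kills the middle term.\<close>

lemma H_op_nonpos_imp_factor:
  assumes V: "linear_isometry V\<^sub>1" "linear_isometry V\<^sub>2" "V\<^sub>1 \<circ> V\<^sub>2 = V\<^sub>2 \<circ> V\<^sub>1"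
    and neg: "operator_le (H_op V\<^sub>1 V\<^sub>2) (\<lambda>_. 0)"
    and w: "w \<in> op_kernel (cadjoint V\<^sub>2)"
  shows "w \<in> op_kernel (cadjoint V\<^sub>1)"
    and "\<exists>u \<in> op_kernel (cadjoint V\<^sub>2). V\<^sub>2 w = V\<^sub>1 u"
proof -
  let ?u = "cadjoint V\<^sub>1 (V\<^sub>2 w)"
  have w0: "cadjoint V\<^sub>2 w = 0"
    using w by (simp add: op_kernel_def)
  have u2: "cadjoint V\<^sub>2 ?u = cadjoint V\<^sub>1 w"
    by (simp add: cadjoint_commute [OF V, symmetric] V)
  have "Re (cinner (H_op V\<^sub>1 V\<^sub>2 (V\<^sub>2 w)) (V\<^sub>2 w)) \<le> 0"
    using neg by (simp add: operator_le_def positive_operator_def cinner_minus_left)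
  then have ineq: "(norm (V\<^sub>2 w))\<^sup>2 + (norm (cadjoint V\<^sub>1 w))\<^sup>2 \<le> (norm ?u)\<^sup>2"
    by (simp add: Re_cinner_H_op [OF V] V w0 u2 linear_isometry_norm [OF V(2)])
  then have "(norm (V\<^sub>2 w))\<^sup>2 \<le> (norm ?u)\<^sup>2"
    by (smt (verit) zero_le_power2)
  then have "norm (V\<^sub>2 w) \<le> norm ?u"
    by (rule power2_le_imp_le) simp
  then have u: "V\<^sub>1 ?u = V\<^sub>2 w"
    by (rule isometry_cadjoint_eqI [OF V(1)])
  have "norm ?u = norm (V\<^sub>2 w)"
    by (metis u linear_isometry_norm [OF V(1)])
  with ineq have "cadjoint V\<^sub>1 w = 0"
    by simp
  with u u2 show "w \<in> op_kernel (cadjoint V\<^sub>1)"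
    and "\<exists>u \<in> op_kernel (cadjoint V\<^sub>2). V\<^sub>2 w = V\<^sub>1 u"
    by (auto simp: op_kernel_def intro!: bexI [of _ ?u])
qed

theorem corollary2p7:
  fixes V\<^sub>1 V\<^sub>2 :: "'a::complex_hilbert \<Rightarrow> 'a"
  assumes "commuting_isometries V\<^sub>1 V\<^sub>2"
    and "finite_dimensional (op_kernel (cadjoint V\<^sub>2)) \<or>
         finite_dimensional (op_kernel (cadjoint V\<^sub>1))"
  shows "(operator_le (\<lambda>_. 0) (H_op V\<^sub>1 V\<^sub>2) \<or> operator_le (H_op V\<^sub>1 V\<^sub>2) (\<lambda>_. 0))
         \<longleftrightarrow> H_op V\<^sub>1 V\<^sub>2 = (\<lambda>_. 0)"
proof
  have V: "linear_isometry V\<^sub>1" "linear_isometry V\<^sub>2" "V\<^sub>1 \<circ> V\<^sub>2 = V\<^sub>2 \<circ> V\<^sub>1"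
    using assms(1) by (auto simp: commuting_isometries_def)
  let ?W1 = "op_kernel (cadjoint V\<^sub>1)" and ?W2 = "op_kernel (cadjoint V\<^sub>2)"
  have W2: "complex_vector.subspace ?W2"
    by (rule subspace_op_kernel [OF cadjoint_clinear [OF V(2)]])
  \<comment> \<open>Either choice of \<open>U\<close> serves both signs: the factor \<open>u\<close>
    lies in both kernels when the operator is nonnegative, and \<open>?W2\<close> is contained in
    \<open>?W1\<close> when it is nonpositive.\<close>
  obtain U where U: "finite_dimensional U" "U = ?W1 \<or> U = ?W2"
    using assms(2) by blast
  assume "operator_le (\<lambda>_. 0) (H_op V\<^sub>1 V\<^sub>2) \<or> operator_le (H_op V\<^sub>1 V\<^sub>2) (\<lambda>_. 0)"
  then have "V\<^sub>1 ` ?W2 = V\<^sub>2 ` ?W2"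
  proof
    assume "operator_le (\<lambda>_. 0) (H_op V\<^sub>1 V\<^sub>2)"
    from H_op_nonneg_imp_factor [OF V this] U(2) show ?thesis
      by (intro isometry_images_eqI [OF V(1,2) W2 U(1)]) blast
  next
    assume "operator_le (H_op V\<^sub>1 V\<^sub>2) (\<lambda>_. 0)"
    from H_op_nonpos_imp_factor [OF V this] U(2) show ?thesis
      by (intro isometry_images_eqI [OF V(2,1) W2 U(1), symmetric]) blast
  qed
  then show "H_op V\<^sub>1 V\<^sub>2 = (\<lambda>_. 0)"
    by (rule H_op_eq_0I [OF V])
next
  assume "H_op V\<^sub>1 V\<^sub>2 = (\<lambda>_. 0)"
  then show "operator_le (\<lambda>_. 0) (H_op V\<^sub>1 V\<^sub>2) \<or> operator_le (H_op V\<^sub>1 V\<^sub>2) (\<lambda>_. 0)"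
    by (simp add: operator_le_def positive_operator_def)
qed

end
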